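(* For $t>0$ let $$S(t)=\sum_{n=1}^\infty \frac{(-1)^n}{n}\,e^{-t/n}.$$ Then, as $t\to+\infty$, $$S(t)\;\sim\;2\pi^{1/4}\,e^{-\sqrt{2\pi t}}\;\frac{\cos\left(\sqrt{2\pi t}+\pi/8\right)}{t^{1/4}},$$ in the sense that $$S(t)-2\pi^{1/4}\,e^{-\sqrt{2\pi t}}\;\frac{\cos\left(\sqrt{2\pi t}+\pi/8\right)}{t^{1/4}}=o\left(t^{-1/4}e^{-\sqrt{2\pi t}}\right)\qquad (t\to+\infty).$$
   Context: The symbol $\sim$ with an oscillating right-hand side means that the error is of smaller order of magnitude than the non-oscillating amplitude factor of the right-hand side (here $t^{-1/4}e^{-\sqrt{2\pi t}}$); the main term itself vanishes for some values of $t$. *)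

theory Defs
  imports Complex_Main "HOL-Library.Landau_Symbols"
begin

(* Library series are indexed from 0, so the n-th term below is the term of index n + 1
   of the series for S(t). *)
definition S_term :: "real \<Rightarrow> nat \<Rightarrow> real" where
  "S_term t n = (-1) ^ Suc n / real (Suc n) * exp (- t / real (Suc n))"

definition S :: "real \<Rightarrow> real" where
  "S t = (\<Sum>n. S_term t n)"

(* The series converges only conditionally; this justifies reading S as its ordinary sum. *)
lemma S_term_sums:
  assumes "t > 0"
  shows "S_term t sums S t"
proof -
  define g where "g x = x * exp (- t * x)" for x :: real
  define N where "N = nat \<lceil>t\<rceil>"
  define a where "a k = g (1 / real (Suc (k + N)))" for k
  have mono: "g x \<le> g y" if "0 \<le> x" "x \<le> y" "y \<le> 1 / t" for x y
  proof (rule DERIV_nonneg_imp_nondecreasing[OF that(2)])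
    fix z assume z: "x \<le> z" "z \<le> y"
    have "(g has_real_derivative exp (- t * z) * (1 - t * z)) (at z)"
      unfolding g_def by (auto intro!: derivative_eq_intros simp: algebra_simps)
    moreover have "t * z \<le> 1"
      using z that assms by (simp add: field_simps)
        (metis order_trans mult.commute mult_left_mono less_imp_le)
    ultimately show "\<exists>d. (g has_real_derivative d) (at z) \<and> 0 \<le> d"
      by (intro exI[of _ "exp (- t * z) * (1 - t * z)"]) auto
  qed
  have le: "1 / real (Suc (k + N)) \<le> 1 / t" for k
  proof -
    have "t \<le> real N" unfolding N_def by linarith
    then show ?thesis using assms by (intro divide_left_mono) auto
  qed
  have "isCont g 0" unfolding g_def by (intro continuous_intros)
  moreover have "(\<lambda>k. 1 / real (Suc (k + N))) \<longlonglongrightarrow> 0"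
    using LIMSEQ_ignore_initial_segment[OF LIMSEQ_inverse_real_of_nat, of N]
    by (simp add: inverse_eq_divide)
  ultimately have "a \<longlonglongrightarrow> g 0"
    unfolding a_def by (rule isCont_tendsto_compose)
  then have lim: "a \<longlonglongrightarrow> 0" by (simp add: g_def)
  have nonneg: "0 \<le> a k" for k by (simp add: a_def g_def)
  have dec: "a (Suc k) \<le> a k" for k
    unfolding a_def by (rule mono[OF _ _ le]) (auto intro!: divide_left_mono)
  have "summable (\<lambda>k. (-1) ^ k * a k)"
    by (rule summable_Leibniz'(1)[OF lim nonneg dec])
  then have "summable (\<lambda>k. (-1) ^ Suc N * ((-1) ^ k * a k))"
    by (rule summable_mult)
  moreover have "(-1) ^ Suc N * ((-1) ^ k * a k) = S_term t (k + N)" for k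
    by (simp add: S_term_def a_def g_def power_add)
  ultimately have "summable (\<lambda>k. S_term t (k + N))" by simp
  then have "summable (S_term t)" by (simp only: summable_iff_shift)
  then show ?thesis unfolding S_def by (rule summable_sums)
qed

end

theory Submission
  imports Defs "HOL-Complex_Analysis.Complex_Analysis" "HOL-Probability.Distributions"
    "HOL-Real_Asymp.Real_Asymp"
begin

text \<open>
  The series is a sum of residues. The function \<open>exp (-t/z) / (z sin (\<pi>z))\<close> has at each positive
  integer \<open>n\<close> a simple pole with residue \<open>(-1)^n / n * exp (-t/n) / \<pi>\<close>, and it decays in the sector
  between the rays of directions \<open>1 - \<i>\<close> and \<open>1 + \<i>\<close>, both at infinity (away from the poles) and at its
  essential singularity \<open>0\<close>. Hence \<open>S t\<close> is an integral over these two rays, that is, minus the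
  imaginary part of the integral over the upper one (\<open>S_term_sums_ray_integral\<close>, obtained from
  the finite contours of \<open>sector_contour\<close>).

  In the upper half plane \<open>1 / sin (\<pi>z) = -2\<i> exp (\<i>\<pi>z) / (1 - exp (2\<pi>\<i>z))\<close>, so the exponent on the
  upper ray is essentially \<open>-t/z + \<i>\<pi>z\<close>. Its saddle point \<open>z = sqrt (t/\<pi>) exp (\<i>\<pi>/4)\<close> lies on that
  ray. With \<open>l = sqrt (2\<pi>t)\<close> and \<open>z = sqrt (t/\<pi>) exp (\<i>\<pi>/4) exp y\<close> the exponent is exactly
  \<open>-(1 - \<i>) l cosh y\<close>: the value at the saddle point has norm \<open>exp (-l)\<close> and phase \<open>l\<close>, and the
  modulus of the exponential is largest there. Scaling \<open>y = x / sqrt l\<close> gives the exact formula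
  \<open>S_eq_saddle_integral\<close>.

  As \<open>l\<close> tends to infinity the scaled integrand converges to \<open>exp (-(1 - \<i>) x\<^sup>2/2)\<close> and is dominated by a
  multiple of \<open>exp (-x\<^sup>2/8)\<close> (\<open>norm_saddle_integrand_le\<close>); the correction \<open>exp (2\<pi>\<i>z)\<close>
  disappears in the limit. Dominated convergence leaves the complex Gaussian integral
  \<open>saddle_gaussian_integral\<close>, whose argument is the phase \<open>\<pi>/8\<close> in the theorem.
\<close>

section \<open>Polygonal contours\<close>

text \<open>
  Each side is seen from \<open>z\<close> in the positive direction and under an angle below \<open>\<pi>\<close>, so it
  contributes strictly between \<open>0\<close> and \<open>1/2\<close>; the four contributions add up to an integer strictly
  between \<open>0\<close> and \<open>2\<close>.
\<close>

lemma winding_number_quadrilateral: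
  fixes a b c d z :: complex
  assumes ab: "0 < Im ((b - a) * cnj (b - z))" and bc: "0 < Im ((c - b) * cnj (c - z))"
    and cd: "0 < Im ((d - c) * cnj (d - z))" and da: "0 < Im ((a - d) * cnj (a - z))"
  defines "p \<equiv> linepath a b +++ linepath b c +++ linepath c d +++ linepath d a"
  shows "z \<notin> path_image p" "winding_number p z = 1"
proof -
  have off: "z \<notin> closed_segment u v" if "0 < Im ((v - u) * cnj (v - z))" for u v
    using that by (simp add: closed_segment_def) (force simp: algebra_simps)
  have pos: "0 < Re (winding_number (linepath u v) z)"
    and half: "\<bar>Re (winding_number (linepath u v) z)\<bar> < 1/2"
    if "0 < Im ((v - u) * cnj (v - z))" for u v
    using winding_number_linepath_pos_lt[OF that] winding_number_lt_half_linepath[OF off[OF that]] by auto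
  show z: "z \<notin> path_image p"
    using off[OF ab] off[OF bc] off[OF cd] off[OF da] by (simp add: p_def path_image_join)
  have W: "Re (winding_number p z) = Re (winding_number (linepath a b) z)
      + Re (winding_number (linepath b c) z) + Re (winding_number (linepath c d) z)
      + Re (winding_number (linepath d a) z)"
    using off[OF ab] off[OF bc] off[OF cd] off[OF da]
    by (simp add: p_def winding_number_join path_image_join)
  show "winding_number p z = 1"
  proof (rule winding_number_eq_1)
    show "valid_path p" "pathfinish p = pathstart p" by (auto simp: p_def intro!: valid_path_join)
    show "0 < Re (winding_number p z)" "Re (winding_number p z) < 2"
      using W pos[OF ab] pos[OF bc] pos[OF cd] pos[OF da]
        half[OF ab] half[OF bc] half[OF cd] half[OF da] by linarith+
  qed (rule z)
qed

text \<open>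
  A function that is singular at the corner \<open>A\<close> of a triangle falls outside the residue theorem
  for that triangle. If the integral around the small triangle at \<open>A\<close> vanishes, the corner can be
  cut off and the residue theorem applied to the remaining quadrilateral.
\<close>

lemma contour_integral_cut_corner:
  fixes f :: "complex \<Rightarrow> complex"
  assumes P: "P \<in> closed_segment A Q" and D: "D \<in> closed_segment A B"
    and AQ: "continuous_on (closed_segment A Q) f" and QB: "continuous_on (closed_segment Q B) f"
    and AB: "continuous_on (closed_segment A B) f" and PD: "continuous_on (closed_segment P D) f"
    and zero: "(f has_contour_integral 0) (linepath A P +++ linepath P D +++ linepath D A)"
  shows "contour_integral (linepath P Q +++ linepath Q B +++ linepath B D +++ linepath D P) f
    = contour_integral (linepath A Q) f + contour_integral (linepath Q B) f
      - contour_integral (linepath A B) f"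
proof -
  have sub: "closed_segment A P \<subseteq> closed_segment A Q" "closed_segment P Q \<subseteq> closed_segment A Q"
      "closed_segment A D \<subseteq> closed_segment A B" "closed_segment D B \<subseteq> closed_segment A B"
    using P D by (auto simp: subset_closed_segment)
  have c: "continuous_on (closed_segment A P) f" "continuous_on (closed_segment P Q) f"
     "continuous_on (closed_segment A D) f" "continuous_on (closed_segment D B) f"
    using sub AQ AB continuous_on_subset by blast+
  have i: "f contour_integrable_on linepath A P" "f contour_integrable_on linepath P Q"
     "f contour_integrable_on linepath D A" "f contour_integrable_on linepath B D"
     "f contour_integrable_on linepath Q B" "f contour_integrable_on linepath P D"
     "f contour_integrable_on linepath D P"
    using c QB PD by (auto intro!: contour_integrable_continuous_linepath simp: closed_segment_commute)
  have rev: "contour_integral (linepath D A) f = - contour_integral (linepath A D) f"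
     "contour_integral (linepath D P) f = - contour_integral (linepath P D) f"
     "contour_integral (linepath B D) f = - contour_integral (linepath D B) f"
    using c PD by (auto intro!: contour_integral_reverse_linepath simp: closed_segment_commute)
  have "contour_integral (linepath A P) f + (contour_integral (linepath P D) f
      + contour_integral (linepath D A) f) = 0"
    using contour_integral_unique[OF zero] i by (simp add: valid_path_join contour_integrable_joinI)
  moreover have "contour_integral (linepath A Q) f
      = contour_integral (linepath A P) f + contour_integral (linepath P Q) f"
    by (rule contour_integral_split_linepath[OF AQ P])
  moreover have "contour_integral (linepath A B) f
      = contour_integral (linepath A D) f + contour_integral (linepath D B) f"
    by (rule contour_integral_split_linepath[OF AB D])
  ultimately show ?thesis using i rev
    by (simp add: valid_path_join contour_integrable_joinI algebra_simps)
qed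

section \<open>The kernel and its residues\<close>

text \<open>
  The residue at a positive integer \<open>n\<close> is \<open>1/\<pi>\<close> times the \<open>n\<close>-th term of the series.
  The totalised division gives \<open>kern t 0 = 0\<close>, which for \<open>t > 0\<close> is also the limit at the origin
  inside the sector \<open>\<bar>arg z\<bar> \<le> \<pi>/4\<close>; the contours below may therefore start at the origin.
\<close>

definition kern :: "real \<Rightarrow> complex \<Rightarrow> complex" where
  "kern t z = exp (- of_real t / z) / z / sin (of_real pi * z)"

lemma sin_pi_mult_eq_0_iff: "sin (of_real pi * z) = 0 \<longleftrightarrow> z \<in> \<int>" for z :: complex
proof -
  have "sin (of_real pi * z) = 0 \<longleftrightarrow> (\<exists>n::int. z = of_int n)"
    by (auto simp: sin_eq_0 mult.commute)
  then show ?thesis by (auto simp: Ints_def)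
qed

lemma Re_half_integer_not_Ints:
  assumes "Re z = real N + 1/2"
  shows "z \<notin> \<int>"
proof
  assume "z \<in> \<int>"
  then obtain k where "z = of_int k" by (rule Ints_cases)
  then have "real_of_int (2 * k) = real_of_int (2 * int N + 1)" using assms by simp
  then have "2 * k = 2 * int N + 1" using of_int_eq_iff by blast
  then show False by presburger
qed

lemma kern_cnj: "kern t (cnj z) = cnj (kern t z)"
  by (simp add: kern_def exp_cnj cnj_sin)

lemma kern_field_differentiable:
  assumes "z \<notin> \<int>"
  shows "kern t field_differentiable at z"
proof -
  have "z \<noteq> 0" using assms by auto
  then show ?thesis
    unfolding kern_def field_differentiable_def using assms
    by (intro exI) (auto intro!: derivative_eq_intros simp: sin_pi_mult_eq_0_iff)
qed

text \<open>
  In the sector, \<open>Re (1/z) = Re z / \<bar>z\<bar>\<^sup>2\<close> is at least \<open>1 / (2 \<bar>z\<bar>)\<close>.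
\<close>

lemma norm_exp_inverse_le:
  fixes z :: complex
  assumes "0 \<le> t" "\<bar>Im z\<bar> \<le> Re z"
  shows "norm (exp (- of_real t / z)) \<le> exp (- t / (2 * norm z))"
proof (cases "z = 0")
  case False
  have "norm z \<le> 2 * Re z" using cmod_le[of z] assms(2) by linarith
  then have "1 / (2 * norm z) \<le> Re z / (norm z)\<^sup>2"
    using False by (simp add: field_simps power2_eq_square)
  then have "t * (1 / (2 * norm z)) \<le> t * (Re z / (norm z)\<^sup>2)"
    by (rule mult_left_mono) (use assms in auto)
  moreover have "Re (- of_real t / z) = - t * (Re z / (norm z)\<^sup>2)"
    by (simp add: Re_divide cmod_power2)
  ultimately show ?thesis by simp
qed simp

text \<open>
  At the origin the kernel is a product of \<open>z / sin (\<pi> z)\<close>, which tends to \<open>1/\<pi>\<close>, and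
  \<open>exp (-t/z) / z\<^sup>2\<close>, whose exponential factor beats every power of \<open>z\<close> inside the sector.
\<close>

lemma kern_continuous_on_sector:
  assumes "t > 0"
  shows "continuous_on {z. \<bar>Im z\<bar> \<le> Re z \<and> (z = 0 \<or> z \<notin> \<int>)} (kern t)" (is "continuous_on ?K _")
  unfolding continuous_on_def
proof
  fix z assume z: "z \<in> ?K"
  show "(kern t \<longlongrightarrow> kern t z) (at z within ?K)"
  proof (cases "z = 0")
    case False
    then have "isCont (kern t) z"
      using z kern_field_differentiable field_differentiable_imp_continuous_at by blast
    then show ?thesis using continuous_at_imp_continuous_within continuous_within by blast
  next
    case True
    have "((\<lambda>w. sin (of_real pi * w)) has_field_derivative of_real pi) (at (0::complex))"
      by (auto intro!: derivative_eq_intros)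
    then have "((\<lambda>w::complex. sin (of_real pi * w) / w) \<longlongrightarrow> of_real pi) (at 0 within ?K)"
      by (auto simp: has_field_derivative_iff intro: tendsto_within_subset)
    then have A: "((\<lambda>w::complex. inverse (sin (of_real pi * w) / w)) \<longlongrightarrow> inverse (of_real pi)) (at 0 within ?K)"
      by (rule tendsto_inverse) auto
    have n: "filterlim norm (at_right 0) (at (0::complex) within ?K)"
      unfolding filterlim_at by (auto simp: eventually_at_filter intro!: tendsto_eq_intros)
    have "((\<lambda>x::real. exp (- t / (2 * x)) / x\<^sup>2) \<longlongrightarrow> 0) (at_right 0)"
      using assms by real_asymp
    from filterlim_compose[OF this n]
    have "((\<lambda>w::complex. exp (- t / (2 * norm w)) / (norm w)\<^sup>2) \<longlongrightarrow> 0) (at 0 within ?K)" .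
    moreover have "norm (exp (- of_real t / w) / w\<^sup>2) \<le> exp (- t / (2 * norm w)) / (norm w)\<^sup>2"
      if "w \<in> ?K" for w
      using norm_exp_inverse_le[of t w] that assms
      by (simp add: norm_divide norm_power divide_right_mono del: norm_exp_eq_Re)
    then have "\<forall>\<^sub>F w in at 0 within ?K.
        norm (exp (- of_real t / w) / w\<^sup>2) \<le> exp (- t / (2 * norm w)) / (norm w)\<^sup>2"
      by (auto simp: eventually_at_filter intro!: always_eventually)
    ultimately have B: "((\<lambda>w. exp (- of_real t / w) / w\<^sup>2) \<longlongrightarrow> 0) (at 0 within ?K)"
      by (rule Lim_null_comparison[rotated])
    have "((\<lambda>w. exp (- of_real t / w) / w\<^sup>2 * inverse (sin (of_real pi * w) / w)) \<longlongrightarrow> 0) (at 0 within ?K)"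
      using tendsto_mult[OF B A] by simp
    moreover have "exp (- of_real t / w) / w\<^sup>2 * inverse (sin (of_real pi * w) / w) = kern t w" for w
      by (simp add: kern_def power2_eq_square divide_simps)
    ultimately have "(kern t \<longlongrightarrow> 0) (at 0 within ?K)" by (simp only:)
    then show ?thesis using True by (simp add: kern_def)
  qed
qed

lemma residue_kern:
  assumes "n > 0"
  shows "residue (kern t) (of_nat n) = of_real ((-1) ^ n / real n * exp (- t / real n)) / of_real pi"
proof -
  have "((\<lambda>w. sin (of_real pi * w)) has_field_derivative of_real pi * cos (of_real pi * of_nat n))
      (at (of_nat n :: complex))"
    by (auto intro!: derivative_eq_intros)
  moreover have c: "cos (of_real pi * of_nat n :: complex) = (-1) ^ n"
    using cos_of_real[of "pi * real n", where 'a=complex] by (simp add: cos_npi2)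
  ultimately have d: "((\<lambda>w. sin (of_real pi * w)) has_field_derivative of_real pi * (-1) ^ n)
      (at (of_nat n :: complex))" by simp
  have "residue (\<lambda>w. (exp (- of_real t / w) / w) / sin (of_real pi * w)) (of_nat n)
      = (exp (- of_real t / of_nat n) / of_nat n) / (of_real pi * (-1) ^ n)"
  proof (rule residue_simple_pole_deriv[OF _ _ _ _ _ d])
    show "(\<lambda>w. exp (- of_real t / w) / w) holomorphic_on {w. 0 < Re w}"
      by (intro holomorphic_intros) auto
    show "(\<lambda>w::complex. sin (of_real pi * w)) holomorphic_on {w. 0 < Re w}"
      by (intro holomorphic_intros)
    show "open {w. 0 < Re w}" by (rule open_halfspace_Re_gt)
    show "connected {w. 0 < Re w}" by (intro convex_connected convex_halfspace_Re_gt)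
    show "sin (of_real pi * of_nat n :: complex) = 0" by (simp add: sin_pi_mult_eq_0_iff)
  qed (use assms in auto)
  also have "\<dots> = of_real ((-1) ^ n / real n * exp (- t / real n)) / of_real pi"
    by (cases "even n") (auto simp flip: exp_of_real)
  finally show ?thesis unfolding kern_def .
qed

text \<open>
  The closed contour runs from \<open>0\<close> along the ray of direction \<open>1 - \<i>\<close>, up the vertical line through
  \<open>N + 1/2\<close>, and back to \<open>0\<close> along the ray of direction \<open>1 + \<i>\<close>. The essential singularity at
  the corner \<open>0\<close> is dealt with by cutting off the triangle left of \<open>Re z = 1/2\<close>, on which Cauchy's
  theorem needs only continuity at the corner; the poles \<open>1, \<dots>, N\<close> lie in the rest.
\<close>

lemma sector_contour:
  fixes N :: nat and t :: real
  assumes "t > 0"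
  defines "R \<equiv> real N + 1/2"
  defines "Q \<equiv> of_real R * (1 - \<i>)" and "B \<equiv> of_real R * (1 + \<i>)"
  shows "contour_integral (linepath 0 Q) (kern t) + contour_integral (linepath Q B) (kern t)
      - contour_integral (linepath 0 B) (kern t)
    = 2 * \<i> * (\<Sum>n=1..N. of_real ((-1) ^ n / real n * exp (- t / real n)))"
proof -
  \<comment> \<open>the two points where the line \<open>Re z = 1/2\<close> meets the rays; for \<open>N = 0\<close> they coincide with \<open>Q\<close> and \<open>B\<close>\<close>
  define P D :: complex where "P = of_real (1/2) * (1 - \<i>)" and "D = of_real (1/2) * (1 + \<i>)"
  define p where "p = linepath P Q +++ linepath Q B +++ linepath B D +++ linepath D P"
  define T where "T = {z. 0 < Re z \<and> Re z < real N + 1}"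
  define pts where "pts = (of_nat ` {1..N} :: complex set)"
  have R: "R \<ge> 1/2" by (simp add: R_def)
  have not_int: "of_real x * (1 - \<i>) \<notin> \<int>" "of_real x * (1 + \<i>) \<notin> \<int>" if "x \<noteq> 0" for x
    using that by (auto elim!: Ints_cases simp: complex_eq_iff)
  let ?K = "{z. \<bar>Im z\<bar> \<le> Re z \<and> (z = 0 \<or> z \<notin> \<int>)}"
  have rays: "closed_segment 0 Q \<subseteq> ?K" "closed_segment 0 B \<subseteq> ?K"
  proof -
    have 1: "of_real u * (of_real R * (1 - \<i>)) = of_real (u * R) * (1 - \<i>)" for u by simp
    have 2: "of_real u * (of_real R * (1 + \<i>)) = of_real (u * R) * (1 + \<i>)" for u by simp
    show "closed_segment 0 Q \<subseteq> ?K"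
      unfolding closed_segment_def Q_def scaleR_conv_of_real 1 using R not_int(1)[of "_ * R"] by auto
    show "closed_segment 0 B \<subseteq> ?K"
      unfolding closed_segment_def B_def scaleR_conv_of_real 2 using R not_int(2)[of "_ * R"] by auto
  qed
  have vert: "closed_segment (Complex x (-x)) (Complex x x) \<subseteq> {z. \<bar>Im z\<bar> \<le> Re z \<and> Re z = x}" if "x > 0" for x
    using that by (auto simp: closed_segment_same_Re closed_segment_eq_real_ivl)
  have QB: "closed_segment Q B \<subseteq> ?K"
  proof -
    have "Q = Complex R (-R)" "B = Complex R R" by (auto simp: Q_def B_def complex_eq_iff)
    moreover have "z \<notin> \<int>" if "Re z = R" for z
      using Re_half_integer_not_Ints[of z N] that by (simp add: R_def)
    ultimately show ?thesis using vert[of R] R by auto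
  qed
  have PDeq: "P = Complex (1/2) (-1/2)" "D = Complex (1/2) (1/2)" by (auto simp: P_def D_def complex_eq_iff)
  have int01: "z \<notin> \<int>" if "0 < Re z" "Re z < 1" for z
    using that by (auto elim!: Ints_cases)
  have PD: "closed_segment P D \<subseteq> ?K" using vert[of "1/2"] PDeq int01 by auto
  note cont = continuous_on_subset[OF kern_continuous_on_sector[OF \<open>t > 0\<close>]]
  let ?S0 = "{z. \<bar>Im z\<bar> \<le> Re z \<and> Re z \<le> 1/2}"
  have "(kern t has_contour_integral 0) (linepath 0 P +++ linepath P D +++ linepath D 0)"
  proof (rule Cauchy_theorem_convex[where S = ?S0 and K = "{0}"])
    have S0: "z = 0 \<or> 0 < Re z \<and> Re z < 1" if "z \<in> ?S0" for z
      using that by (cases "Re z = 0") (auto simp: complex_eq_iff)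
    then have "?S0 \<subseteq> ?K" using int01 by blast
    then show "continuous_on ?S0 (kern t)" by (rule cont)
    have eq: "?S0 = {z. Im z - Re z \<le> 0} \<inter> {z. - Im z - Re z \<le> 0} \<inter> {z. Re z \<le> 1/2}" by auto
    have c1: "convex {z. Im z - Re z \<le> 0}"
      using convex_halfspace_le[of "Complex (-1) 1" 0] by (simp add: inner_complex_def)
    have c2: "convex {z. - Im z - Re z \<le> 0}"
      using convex_halfspace_le[of "Complex (-1) (-1)" 0] by (simp add: inner_complex_def algebra_simps)
    show conv: "convex ?S0" by (subst eq) (intro convex_Int convex_halfspace_Re_le c1 c2)
    show "kern t field_differentiable at x" if "x \<in> interior ?S0 - {0}" for x
      using that S0 interior_subset int01 kern_field_differentiable by blast
    have "0 \<in> ?S0" "P \<in> ?S0" "D \<in> ?S0" by (auto simp: PDeq)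
    then show "path_image (linepath 0 P +++ linepath P D +++ linepath D 0) \<subseteq> ?S0"
      using conv by (simp add: path_image_join closed_segment_subset)
  qed (auto intro!: valid_path_join)
  then have cut: "contour_integral p (kern t) = contour_integral (linepath 0 Q) (kern t)
      + contour_integral (linepath Q B) (kern t) - contour_integral (linepath 0 B) (kern t)"
    unfolding p_def
  proof (rule contour_integral_cut_corner[rotated -1])
    show "P \<in> closed_segment 0 Q" "D \<in> closed_segment 0 B"
      unfolding closed_segment_def P_def D_def Q_def B_def using R
      by (auto intro!: exI[of _ "1 / (2 * R)"] simp: scaleR_conv_of_real)
  qed (intro cont rays QB PD)+
  have conv: "convex T"
    unfolding T_def Collect_conj_eq by (intro convex_Int convex_halfspace_Re_gt convex_halfspace_Re_lt)
  have "P \<in> T" "Q \<in> T" "B \<in> T" "D \<in> T" using R by (auto simp: T_def P_def Q_def B_def D_def R_def)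
  then have pT: "path_image p \<subseteq> T"
    using conv by (simp add: p_def path_image_join closed_segment_subset)
  have wind: "of_nat n \<notin> path_image p \<and> winding_number p (of_nat n) = 1" if "n \<in> {1..N}" for n
  proof -
    have n: "1 \<le> real n" "real n < R" using that by (auto simp: R_def)
    then show ?thesis unfolding p_def
      using R by (intro conjI winding_number_quadrilateral)
        (auto simp: P_def Q_def B_def D_def algebra_simps)
  qed
  have "contour_integral p (kern t) = 2 * pi * \<i> * (\<Sum>z\<in>pts. winding_number p z * residue (kern t) z)"
  proof (rule Residue_theorem)
    show "open T" unfolding T_def Collect_conj_eq
      by (intro open_Int open_halfspace_Re_gt open_halfspace_Re_lt)
    show "connected T" by (rule convex_connected[OF conv])
    show "finite pts" by (simp add: pts_def)
    have "z \<in> pts" if "z \<in> T" "z \<in> \<int>" for z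
    proof -
      obtain k where k: "z = of_int k" using \<open>z \<in> \<int>\<close> by (rule Ints_cases)
      then have "0 < k" "k < int N + 1" using that(1) unfolding T_def by auto
      then have "z = of_nat (nat k)" "nat k \<in> {1..N}" using k by auto
      then show ?thesis by (auto simp: pts_def)
    qed
    then show "kern t holomorphic_on T - pts"
      by (auto simp: holomorphic_on_def intro!: field_differentiable_at_within kern_field_differentiable)
    show "valid_path p" "pathfinish p = pathstart p" by (auto simp: p_def intro!: valid_path_join)
    show "path_image p \<subseteq> T - pts" using pT wind by (auto simp: pts_def)
    show "\<forall>z. z \<notin> T \<longrightarrow> winding_number p z = 0"
      using pT conv by (auto intro!: winding_number_zero_outside[where s = T] valid_path_imp_path
          simp: p_def valid_path_join)
  qed
  also have "(\<Sum>z\<in>pts. winding_number p z * residue (kern t) z)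
      = (\<Sum>n=1..N. residue (kern t) (of_nat n))"
    unfolding pts_def by (subst sum.reindex) (use wind in \<open>auto simp: inj_on_def\<close>)
  also have "\<dots> = (\<Sum>n=1..N. of_real ((-1) ^ n / real n * exp (- t / real n)) / of_real pi)"
    by (intro sum.cong residue_kern refl) auto
  finally show ?thesis unfolding cut sum_divide_distrib[symmetric] by simp
qed

section \<open>The series as an integral along a ray\<close>

text \<open>
  A weaker constant than the optimal \<open>1/2\<close> that follows from the Taylor bound for \<open>exp \<bar>x\<bar>\<close> and
  the tangent bound for \<open>exp (- \<bar>x\<bar>)\<close>.
\<close>

lemma cosh_ge_quadratic: "1 + x\<^sup>2 / 4 \<le> cosh x" for x :: real
proof -
  have "1 + y\<^sup>2 / 4 \<le> cosh y" if "y \<ge> 0" for y :: real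
    using exp_lower_Taylor_quadratic[OF that] exp_ge_add_one_self[of "-y"]
    by (simp add: cosh_def)
  from this[of "\<bar>x\<bar>"] show ?thesis by simp
qed

text \<open>
  On the line \<open>Re z = N + 1/2\<close> one has \<open>\<bar>sin (\<pi> z)\<bar> = cosh (\<pi> y)\<close>, since \<open>cos (2 \<pi> Re z) = -1\<close>.
\<close>

lemma norm_kern_vertical_le:
  assumes "t > 0" "\<bar>y\<bar> \<le> real N + 1/2"
  shows "norm (kern t (Complex (real N + 1/2) y)) \<le> 1 / (real N + 1/2) * (1 / (1 + y\<^sup>2))"
proof -
  define R z where "R = real N + 1/2" and "z = Complex R y"
  have R: "R > 0" by (simp add: R_def)
  have "norm (exp (- of_real t / z)) \<le> exp (- t / (2 * norm z))"
    using assms by (intro norm_exp_inverse_le) (auto simp: z_def R_def)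
  also have "\<dots> \<le> 1" using assms by simp
  finally have e: "norm (exp (- of_real t / z)) \<le> 1" .
  have n: "R \<le> norm z" using complex_Re_le_cmod[of z] by (simp add: z_def)
  have "cos (2 * (pi * R)) = cos (2 * real N * pi + pi)" by (simp add: R_def algebra_simps)
  also have "\<dots> = -1" by (simp only: cos_add cos_2npi sin_pi cos_pi)
  finally have cosR: "cos (2 * Re (of_real pi * z)) = -1" by (simp add: z_def)
  have "exp (2 * Im (of_real pi * z)) = (exp (pi * y))\<^sup>2"
    by (simp add: z_def power2_eq_square flip: exp_add)
  then have "(norm (sin (of_real pi * z)))\<^sup>2 = (cosh (pi * y))\<^sup>2"
    unfolding norm_sin_squared cosR cosh_field_def exp_minus
    by (simp add: power2_eq_square field_simps)
  then have s: "norm (sin (of_real pi * z)) = cosh (pi * y)" by simp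
  have "1 + y\<^sup>2 \<le> 1 + (pi * y)\<^sup>2 / 4"
    using mult_right_mono[of "2^2" "pi^2" "y^2"] power_mono[OF pi_ge_two, of 2] by (simp add: power_mult_distrib)
  also have "\<dots> \<le> cosh (pi * y)" by (rule cosh_ge_quadratic)
  finally have c: "1 + y\<^sup>2 \<le> cosh (pi * y)" .
  have "norm (kern t z) = norm (exp (- of_real t / z)) / norm z / cosh (pi * y)"
    unfolding kern_def by (simp only: norm_divide s)
  also have "\<dots> \<le> 1 / R / (1 + y\<^sup>2)"
    using e n c R by (intro frac_le) (auto intro!: add_pos_nonneg)
  finally show ?thesis by (simp add: z_def R_def)
qed

text \<open>
  The side has length proportional to \<open>N\<close> and the factor \<open>1/z\<close> only saves a power \<open>1/N\<close>; the
  integrable factor \<open>1 / (1 + y\<^sup>2)\<close> makes the integral \<open>O(1/N)\<close>.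
\<close>

lemma vertical_side_tendsto_0:
  assumes "t > 0"
  shows "(\<lambda>N. contour_integral (linepath (of_real (real N + 1/2) * (1 - \<i>)) (of_real (real N + 1/2) * (1 + \<i>)))
      (kern t)) \<longlonglongrightarrow> 0"
proof (rule Lim_null_comparison)
  show "\<forall>\<^sub>F N in sequentially. norm (contour_integral (linepath (of_real (real N + 1/2) * (1 - \<i>))
      (of_real (real N + 1/2) * (1 + \<i>))) (kern t)) \<le> pi / (real N + 1/2)"
  proof (rule always_eventually, rule allI)
    fix N :: nat
    define R where "R = real N + 1/2"
    have R: "R > 0" by (simp add: R_def)
    have "((\<lambda>y. 1 / R * (1 / (1 + y\<^sup>2))) has_integral (1 / R * (arctan R - arctan (-R)))) {-R..R}"
    proof (intro has_integral_mult_right fundamental_theorem_of_calculus)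
      show "(arctan has_vector_derivative 1 / (1 + x\<^sup>2)) (at x within {-R..R})" for x
        by (auto intro!: derivative_eq_intros simp: inverse_eq_divide
            simp flip: has_real_derivative_iff_has_vector_derivative)
    qed (use R in auto)
    then have I: "(\<lambda>y. 1 / R * (1 / (1 + y\<^sup>2))) integrable_on {-R..R}"
        "integral {-R..R} (\<lambda>y. 1 / R * (1 / (1 + y\<^sup>2))) = 1 / R * (2 * arctan R)"
      by (auto simp: arctan_minus dest: integral_unique)
    have "continuous_on {-R..R} (\<lambda>y. kern t (Complex R y))"
    proof (rule continuous_on_compose2[where f = "Complex R" and g = "kern t"])
      show "continuous_on {z. \<bar>Im z\<bar> \<le> Re z \<and> (z = 0 \<or> z \<notin> \<int>)} (kern t)"
        by (rule kern_continuous_on_sector[OF assms])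
      show "continuous_on {-R..R} (Complex R)" unfolding Complex_eq by (intro continuous_intros)
      have "Complex R y \<notin> \<int>" for y
        by (rule Re_half_integer_not_Ints[of _ N]) (simp add: R_def)
      then show "Complex R ` {-R..R} \<subseteq> {z. \<bar>Im z\<bar> \<le> Re z \<and> (z = 0 \<or> z \<notin> \<int>)}" by auto
    qed
    then have i: "(\<lambda>y. kern t (Complex R y)) integrable_on {-R..R}" by (rule integrable_continuous_real)
    have "contour_integral (linepath (of_real R * (1 - \<i>)) (of_real R * (1 + \<i>))) (kern t)
        = \<i> * integral {-R..R} (\<lambda>y. kern t (Complex R y))"
      by (rule contour_integral_linepath_same_Re) (use R in auto)
    then have "norm (contour_integral (linepath (of_real R * (1 - \<i>)) (of_real R * (1 + \<i>))) (kern t))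
        = norm (integral {-R..R} (\<lambda>y. kern t (Complex R y)))"
      by (simp add: norm_mult)
    also have "\<dots> \<le> integral {-R..R} (\<lambda>y. 1 / R * (1 / (1 + y\<^sup>2)))"
      unfolding R_def
      by (intro integral_norm_bound_integral I(1)[unfolded R_def] i[unfolded R_def] norm_kern_vertical_le assms) auto
    also have "\<dots> \<le> pi / R" 
      unfolding I(2) using R arctan_ubound[of R] by (simp add: divide_right_mono)
    finally show "norm (contour_integral (linepath (of_real (real N + 1/2) * (1 - \<i>))
      (of_real (real N + 1/2) * (1 + \<i>))) (kern t)) \<le> pi / (real N + 1/2)" by (simp only: R_def)
  qed
  show "(\<lambda>N. pi / (real N + 1/2)) \<longlonglongrightarrow> 0" by real_asymp
qed

definition ray_kern :: "real \<Rightarrow> real \<Rightarrow> complex" where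
  "ray_kern t r = kern t (of_real r * (1 + \<i>)) * (1 + \<i>)"

lemma contour_integral_ray:
  assumes "R > 0"
  shows "contour_integral (linepath 0 (of_real R * (1 + \<i>))) (kern t) = integral {0..R} (ray_kern t)"
proof -
  let ?f = "\<lambda>x. of_real R * ray_kern t (R * x)"
  have "contour_integral (linepath 0 (of_real R * (1 + \<i>))) (kern t) = integral {0..1} ?f"
    by (simp add: contour_integral_integral linepath_def ray_kern_def scaleR_conv_of_real mult_ac)
  also have "{0..1} = (\<lambda>x. x / R) ` {0..R}"
    using assms by (auto simp: image_divide_atLeastAtMost)
  also have "integral \<dots> ?f = of_real R * integral ((\<lambda>x. x / R) ` {0..R}) (\<lambda>x. ray_kern t (R * x))"
    by (rule integral_mult_right)
  also have "\<dots> = integral {0..R} (ray_kern t)"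
    using assms by (subst integral_stretch_real) (auto simp: scaleR_conv_of_real)
  finally show ?thesis .
qed

text \<open>
  The two rays are complex conjugate to each other and so are the values of the kernel on them,
  hence their joint contribution is \<open>-2\<i>\<close> times the imaginary part of one of them.
\<close>

lemma S_term_sums_ray_integral:
  assumes t: "t > 0" and int: "ray_kern t absolutely_integrable_on {0<..}"
  shows "S_term t sums (- Im (integral {0<..} (ray_kern t)))"
proof -
  define R where "R N = real N + 1/2" for N
  define V where "V N = contour_integral (linepath (of_real (R N) * (1 - \<i>)) (of_real (R N) * (1 + \<i>))) (kern t)" for N
  have partial: "(\<Sum>k<N. S_term t k) = - Im (integral {0..R N} (ray_kern t)) + Im (V N) / 2" for N
  proof -
    define I where "I = contour_integral (linepath 0 (of_real (R N) * (1 + \<i>))) (kern t)"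
    have "cnj \<circ> linepath 0 (of_real (R N) * (1 + \<i>)) = linepath 0 (of_real (R N) * (1 - \<i>))"
      by (auto simp: linepath_def fun_eq_iff)
    moreover have "cnj \<circ> kern t \<circ> cnj = kern t" by (simp add: fun_eq_iff kern_cnj)
    ultimately have cI: "contour_integral (linepath 0 (of_real (R N) * (1 - \<i>))) (kern t) = cnj I"
      using contour_integral_cnj[of "linepath 0 (of_real (R N) * (1 + \<i>))" "kern t"]
      by (simp add: I_def)
    have "(\<Sum>n=1..N. (-1) ^ n / real n * exp (- t / real n)) = (\<Sum>k<N. S_term t k)"
      by (rule sum.reindex_bij_witness[of _ Suc "\<lambda>n. n - 1"]) (auto simp: S_term_def)
    then have "cnj I + V N - I = 2 * \<i> * of_real (\<Sum>k<N. S_term t k)"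
      using sector_contour[OF t, of N]
      unfolding V_def I_def[symmetric] R_def[symmetric] cI of_real_sum[symmetric] by (simp only:)
    then have "Im (cnj I + V N - I) = 2 * (\<Sum>k<N. S_term t k)" by simp
    moreover have "I = integral {0..R N} (ray_kern t)"
      unfolding I_def by (rule contour_integral_ray) (simp add: R_def)
    ultimately show ?thesis by simp
  qed
  have 0: "ray_kern t r = 0" if "r \<in> {0..} - {0<..}" for r
    using that by (auto simp: ray_kern_def kern_def)
  have int0: "ray_kern t absolutely_integrable_on {0..}"
    using int by (rule absolutely_integrable_spike_set) (use 0 in \<open>auto intro!: negligible_subset[of "{}"]\<close>)
  then have "((\<lambda>b. LINT r:{0..b}|lebesgue. ray_kern t r) \<longlongrightarrow> (LINT r:{0..}|lebesgue. ray_kern t r)) at_top"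
    by (intro tendsto_set_lebesgue_integral_at_top) auto
  moreover have "(LINT r:{0..}|lebesgue. ray_kern t r) = integral {0<..} (ray_kern t)"
    unfolding set_lebesgue_integral_eq_integral(2)[OF int0]
    by (rule integral_spike_set) (use 0 in \<open>auto intro!: negligible_subset[of "{}"]\<close>)
  moreover have "(LINT r:{0..b}|lebesgue. ray_kern t r) = integral {0..b} (ray_kern t)" for b
    by (intro set_lebesgue_integral_eq_integral(2) set_integrable_subset[OF int0]) auto
  ultimately have "((\<lambda>b. integral {0..b} (ray_kern t)) \<longlongrightarrow> integral {0<..} (ray_kern t)) at_top"
    by simp
  moreover have "filterlim R at_top sequentially" unfolding R_def by real_asymp
  ultimately have "(\<lambda>N. integral {0..R N} (ray_kern t)) \<longlonglongrightarrow> integral {0<..} (ray_kern t)"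
    by (rule filterlim_compose)
  moreover have "V \<longlonglongrightarrow> 0"
    unfolding V_def R_def by (rule vertical_side_tendsto_0[OF t])
  ultimately have "(\<lambda>N. - Im (integral {0..R N} (ray_kern t)) + Im (V N) / 2)
      \<longlonglongrightarrow> - Im (integral {0<..} (ray_kern t)) + Im 0 / 2"
    by (intro tendsto_intros) auto
  then show ?thesis by (simp add: sums_def partial)
qed

section \<open>The integral centred at the saddle point\<close>

text \<open>
  The integrand on the ray after \<open>r = l / (2\<pi>) exp (x / sqrt l)\<close> with \<open>l = sqrt (2 \<pi> t)\<close>, without
  its constant factor. The saddle point is at \<open>x = 0\<close>, and \<open>x\<close> is scaled to the width of the peak. The
  numerator is \<open>exp (- t/z + \<i>\<pi>z)\<close> divided by its value at the saddle point, and the denominator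
  is \<open>1 - exp (2\<pi>\<i>z)\<close>, which comes from the sine and tends to \<open>1\<close>.
\<close>

definition saddle_integrand :: "real \<Rightarrow> real \<Rightarrow> complex" where
  "saddle_integrand l x = exp (- (1 - \<i>) * of_real (l * (cosh (x / sqrt l) - 1)))
     / (1 - exp (- (1 - \<i>) * of_real (l * exp (x / sqrt l))))"

lemma saddle_integrand_measurable [measurable]: "saddle_integrand l \<in> borel_measurable borel"
  unfolding saddle_integrand_def cosh_def by measurable

lemma integrable_exp_neg_square: "c > 0 \<Longrightarrow> integrable lborel (\<lambda>x::real. exp (- c * x\<^sup>2))"
proof -
  assume c: "c > 0"
  define s where "s = 1 / sqrt (2 * c)"
  have s: "s > 0" "2 * s\<^sup>2 = 1 / c" using c by (auto simp: s_def power_divide)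
  have "integrable lborel (\<lambda>x. sqrt (2 * pi * s\<^sup>2) * normal_density 0 s x)"
    using s by simp
  moreover have "sqrt (2 * pi * s\<^sup>2) * normal_density 0 s x = exp (- c * x\<^sup>2)" for x
    using s c by (simp add: normal_density_def)
  ultimately show ?thesis by simp
qed

text \<open>
  A bound independent of \<open>l\<close>. The numerator is at most \<open>exp (-x\<^sup>2/4)\<close>. With
  \<open>a = l exp (x / sqrt l)\<close> the denominator has norm at least \<open>1 - exp (-a)\<close>, so its reciprocal is at
  most \<open>1 + 1/a \<le> 1 + exp \<bar>x\<bar>\<close>, and \<open>\<bar>x\<bar> \<le> x\<^sup>2/8 + 2\<close>.
\<close>

lemma norm_saddle_integrand_le:
  assumes "l \<ge> 1"
  shows "norm (saddle_integrand l x) \<le> (1 + exp 2) * exp (- (1 / 8) * x\<^sup>2)"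
proof -
  define y where "y = x / sqrt l"
  define a where "a = l * exp y"
  have a: "a > 0" using assms by (simp add: a_def)
  have "norm (1 - exp (- (1 - \<i>) * of_real a)) \<ge> 1 - exp (- a)"
    using norm_triangle_ineq2[of 1 "exp (- (1 - \<i>) * of_real a)"] by simp
  moreover have ea: "1 - exp (- a) > 0" using a by simp
  ultimately have d: "1 / norm (1 - exp (- (1 - \<i>) * of_real a)) \<le> 1 / (1 - exp (- a))"
    by (intro divide_left_mono) (auto intro!: mult_pos_pos)
  also have "\<dots> \<le> 1 + 1 / a"
  proof -
    have "exp (- a) * (1 + a) \<le> exp (-a) * exp a"
      by (intro mult_left_mono exp_ge_add_one_self) auto
    then have "exp (- a) * (1 + a) \<le> 1" by (simp flip: exp_add)
    then show ?thesis using a ea by (simp add: field_simps)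
  qed
  also have "1 / a \<le> exp \<bar>x\<bar>"
  proof -
    have "- x / sqrt l \<le> \<bar>x\<bar> / sqrt l" using assms by (intro divide_right_mono) auto
    then have "- y \<le> \<bar>x\<bar> / sqrt l" by (simp add: y_def)
    also have "\<dots> \<le> \<bar>x\<bar> / 1" using assms by (intro divide_left_mono) auto
    finally have "exp (- y) \<le> exp \<bar>x\<bar>" by simp
    moreover have "1 / a \<le> exp (- y)"
      using assms unfolding a_def exp_minus by (simp add: field_simps)
    ultimately show ?thesis by linarith
  qed
  finally have D: "1 / norm (1 - exp (- (1 - \<i>) * of_real a)) \<le> 1 + exp \<bar>x\<bar>" by simp
  have "l * y\<^sup>2 = x\<^sup>2" using assms by (simp add: y_def power_divide)
  moreover have "l * (y\<^sup>2 / 4) \<le> l * (cosh y - 1)"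
    using cosh_ge_quadratic[of y] assms by (intro mult_left_mono) auto
  ultimately have N: "exp (- (l * (cosh y - 1))) \<le> exp (- (x\<^sup>2 / 4))" by simp
  have "norm (saddle_integrand l x)
      = exp (- (l * (cosh y - 1))) * (1 / norm (1 - exp (- (1 - \<i>) * of_real a)))"
    unfolding saddle_integrand_def y_def[symmetric] a_def[symmetric] norm_divide by simp
  also have "\<dots> \<le> exp (- (x\<^sup>2 / 4)) * (1 + exp \<bar>x\<bar>)"
    by (intro mult_mono N D) auto
  also have "\<dots> = exp (- (x\<^sup>2 / 4)) + exp (\<bar>x\<bar> - x\<^sup>2 / 4)"
    by (simp add: distrib_left flip: exp_add)
  also have "\<dots> \<le> exp (- (1 / 8) * x\<^sup>2) + exp (2 - 1 / 8 * x\<^sup>2)"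
  proof (intro add_mono)
    have "0 \<le> (\<bar>x\<bar> - 4)\<^sup>2" by simp
    then have "\<bar>x\<bar> - x\<^sup>2 / 4 \<le> 2 - 1 / 8 * x\<^sup>2" by (simp add: power2_diff)
    then show "exp (\<bar>x\<bar> - x\<^sup>2 / 4) \<le> exp (2 - 1 / 8 * x\<^sup>2)" by simp
  qed simp
  also have "\<dots> = (1 + exp 2) * exp (- (1 / 8) * x\<^sup>2)"
    by (simp add: distrib_right flip: exp_add)
  finally show ?thesis .
qed

lemma integrable_saddle_integrand:
  assumes "l \<ge> 1"
  shows "integrable lborel (saddle_integrand l)"
proof (rule Bochner_Integration.integrable_bound)
  show "integrable lborel (\<lambda>x::real. (1 + exp 2) * exp (- (1 / 8) * x\<^sup>2))"
    by (intro integrable_mult_right integrable_exp_neg_square) auto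
qed (use norm_saddle_integrand_le[OF assms] in \<open>auto intro: order_trans[OF _ abs_ge_self]\<close>)

lemma saddle_integral_tendsto:
  "((\<lambda>l. LINT x|lborel. saddle_integrand l x) \<longlongrightarrow> (LINT x|lborel. exp (- (1 - \<i>) * of_real (x\<^sup>2 / 2)))) at_top"
proof (rule integral_dominated_convergence_at_top)
  show "integrable lborel (\<lambda>x::real. (1 + exp 2) * exp (- (1 / 8) * x\<^sup>2))"
    by (intro integrable_mult_right integrable_exp_neg_square) auto
  show "\<forall>\<^sub>F l in at_top. AE x in lborel. norm (saddle_integrand l x) \<le> (1 + exp 2) * exp (- (1 / 8) * x\<^sup>2)"
    using eventually_ge_at_top[of 1] by eventually_elim (use norm_saddle_integrand_le in auto)
  show "AE x in lborel. ((\<lambda>l. saddle_integrand l x) \<longlongrightarrow> exp (- (1 - \<i>) * of_real (x\<^sup>2 / 2))) at_top"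
  proof (rule AE_I2)
    fix x :: real
    have "((\<lambda>l. l * (cosh (x / sqrt l) - 1)) \<longlongrightarrow> x * x / 2) at_top"
      unfolding cosh_field_def by real_asymp
    then have "((\<lambda>l. l * (cosh (x / sqrt l) - 1)) \<longlongrightarrow> x\<^sup>2 / 2) at_top"
      by (simp add: power2_eq_square)
    then have num: "((\<lambda>l. exp (- (1 - \<i>) * of_real (l * (cosh (x / sqrt l) - 1))))
        \<longlongrightarrow> exp (- (1 - \<i>) * of_real (x\<^sup>2 / 2))) at_top"
      by (intro tendsto_intros)
    have "((\<lambda>l. exp (- (l * exp (x / sqrt l)))) \<longlongrightarrow> 0) at_top" by real_asymp
    then have "((\<lambda>l. exp (- (1 - \<i>) * of_real (l * exp (x / sqrt l)))) \<longlongrightarrow> 0) at_top"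
      by (subst tendsto_norm_zero_iff[symmetric]) simp
    from tendsto_divide[OF num tendsto_diff[OF tendsto_const[of 1] this]]
    show "((\<lambda>l. saddle_integrand l x) \<longlongrightarrow> exp (- (1 - \<i>) * of_real (x\<^sup>2 / 2))) at_top"
      by (simp add: saddle_integrand_def)
  qed
qed auto

text \<open>
  With \<open>z = r (1 + \<i>)\<close> and \<open>y = x / sqrt l\<close>, the exponents \<open>-t/z\<close> and \<open>\<i>\<pi>z\<close> become
  \<open>-(1 - \<i>) l exp (-y) / 2\<close> and \<open>-(1 - \<i>) l exp y / 2\<close>, which add up to \<open>-(1 - \<i>) l cosh y\<close>.
\<close>

lemma S_eq_saddle_integral:
  assumes t: "t \<ge> 1"
  defines "l \<equiv> sqrt (2 * pi * t)"
  shows "S t = 2 / sqrt l * Re (exp (- (1 - \<i>) * of_real l) * (LINT x|lborel. saddle_integrand l x))"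
proof -
  have "1 * 1 \<le> 2 * pi * t" using t pi_ge_two by (intro mult_mono) auto
  then have l1: "l \<ge> 1" by (simp add: l_def)
  have l2: "l\<^sup>2 = 2 * pi * t" using t by (simp add: l_def)
  define g where "g x = l / (2 * pi) * exp (x / sqrt l)" for x
  define g' where "g' x = g x / sqrt l" for x
  \<comment> \<open>\<open>-2\<i>\<close> comes from \<open>1 / sin (\<pi>z) = -2\<i> w / (1 - w\<^sup>2)\<close> with \<open>w = exp (\<i>\<pi>z)\<close>, the exponential is the saddle value\<close>
  define c where "c = - 2 * \<i> * exp (- (1 - \<i>) * of_real l) / of_real (sqrt l)"
  have g: "g x > 0" for x using l1 by (simp add: g_def)
  have sub: "\<bar>g' x\<bar> *\<^sub>R ray_kern t (g x) = c * saddle_integrand l x" for x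
  proof -
    define y where "y = x / sqrt l"
    define z where "z = of_real (g x) * (1 + \<i>)"
    have z0: "z \<noteq> 0" using g[of x] by (auto simp: z_def complex_eq_iff)
    have e1: "exp (- of_real t / z) = exp (- (1 - \<i>) * of_real (l * exp (- y) / 2))"
    proof -
      have "of_real t = (1 - \<i>) * of_real (l * exp (- y) / 2) * z"
        using l2 l1 unfolding z_def g_def y_def[symmetric] 
        by (simp add: complex_eq_iff field_simps power2_eq_square exp_minus)
      then have "of_real t / z = (1 - \<i>) * of_real (l * exp (- y) / 2)" using z0 by simp
      then show ?thesis by (simp only: minus_divide_left[symmetric] mult_minus_left)
    qed
    have e2: "\<i> * (of_real pi * z) = - (1 - \<i>) * of_real (l * exp y / 2)"
      by (simp add: z_def g_def y_def complex_eq_iff)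
    define w where "w = exp (\<i> * (of_real pi * z))"
    have w2: "exp (- (1 - \<i>) * of_real (l * exp y)) = w\<^sup>2"
      unfolding w_def e2 by (simp add: power2_eq_square mult_ac flip: exp_add)
    have w0: "w \<noteq> 0" by (simp add: w_def)
    have sinw: "sin (of_real pi * z) = (w - inverse w) / (2 * \<i>)"
      by (simp add: sin_exp_eq w_def exp_minus)
    have inv: "1 / sin (of_real pi * z) = - 2 * \<i> * w / (1 - w\<^sup>2)"
    proof (cases "w\<^sup>2 = 1")
      \<comment> \<open>both sides are divisions by zero\<close>
      case True
      then have "w - inverse w = 0" using w0 by (simp add: field_simps power2_eq_square)
      then show ?thesis unfolding sinw True by simp
    next
      case False
      then have "w - inverse w \<noteq> 0" using w0 by (simp add: field_simps power2_eq_square)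
      then show ?thesis using False w0 unfolding sinw
        by (simp add: divide_simps power2_eq_square)
    qed
    have num: "exp (- of_real t / z) * w = exp (- (1 - \<i>) * of_real l) * exp (- (1 - \<i>) * of_real (l * (cosh y - 1)))"
      unfolding e1 w_def e2 exp_add[symmetric]
      by (rule arg_cong[where f = exp]) (simp add: cosh_field_def field_simps)
    have "\<bar>g' x\<bar> *\<^sub>R ray_kern t (g x)
        = of_real (g x) * ((1 + \<i>) * (exp (- of_real t / z) / z / sin (of_real pi * z) / of_real (sqrt l)))"
      unfolding ray_kern_def kern_def z_def[symmetric] g'_def
      using g[of x] l1 by (simp add: scaleR_conv_of_real mult_ac)
    also have "\<dots> = z * (exp (- of_real t / z) / z / sin (of_real pi * z) / of_real (sqrt l))"
      by (simp only: z_def mult.assoc)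
    also have "\<dots> = exp (- of_real t / z) / of_real (sqrt l) * (1 / sin (of_real pi * z))"
      using z0 by simp
    also have "\<dots> = - 2 * \<i> * (exp (- of_real t / z) * w) / of_real (sqrt l) / (1 - w\<^sup>2)"
      unfolding inv by simp
    also have "\<dots> = c * saddle_integrand l x"
      unfolding num saddle_integrand_def y_def[symmetric] w2 c_def by simp
    finally show ?thesis .
  qed
  have range_g: "range g = {0<..}"
  proof (intro equalityI subsetI)
    fix r :: real assume "r \<in> {0<..}"
    then have "r = g (sqrt l * ln (r * 2 * pi / l))" using l1 by (simp add: g_def)
    then show "r \<in> range g" by blast
  qed (use g in auto)
  have inj: "inj g" using l1 by (auto simp: inj_def g_def)
  have der: "(g has_field_derivative g' x) (at x within UNIV)" for x
  proof -
    define s where "s = sqrt l"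
    have "s \<noteq> 0" using l1 by (simp add: s_def)
    then show ?thesis
      unfolding g'_def g_def s_def[symmetric] by (auto intro!: derivative_eq_intros simp: field_simps)
  qed
  have int: "integrable lborel (\<lambda>x. c * saddle_integrand l x)"
    by (intro integrable_mult_right integrable_saddle_integrand l1)
  then have "(\<lambda>x. \<bar>g' x\<bar> *\<^sub>R ray_kern t (g x)) absolutely_integrable_on UNIV"
    unfolding sub set_integrable_def by (simp add: integrable_completion)
  moreover have "integral UNIV (\<lambda>x. \<bar>g' x\<bar> *\<^sub>R ray_kern t (g x)) = c * (LINT x|lborel. saddle_integrand l x)"
    unfolding sub integral_unique[OF has_integral_integral_lborel[OF int]] by simp
  ultimately have ray: "ray_kern t absolutely_integrable_on {0<..}"
      "integral {0<..} (ray_kern t) = c * (LINT x|lborel. saddle_integrand l x)"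
    using has_absolute_integral_change_of_variables_real[of UNIV g g' "ray_kern t"] der inj
    unfolding range_g by auto
  have im: "- Im (of_real a * (- \<i> * w)) = a * Re w" for a w by simp
  have "S t = - Im (c * (LINT x|lborel. saddle_integrand l x))"
    using S_term_sums_ray_integral[OF _ ray(1)] t ray(2) by (simp add: S_def sums_iff)
  also have "c * J = of_real (2 / sqrt l) * (- \<i> * (exp (- (1 - \<i>) * of_real l) * J))" for J
    by (simp add: c_def)
  finally show ?thesis by (simp only: im)
qed

section \<open>A complex Gaussian integral\<close>

lemma gaussian_moment_even_pochhammer:
  "has_bochner_integral lborel (\<lambda>x::real. exp (- x\<^sup>2) * x ^ (2 * k)) (sqrt pi * pochhammer (1 / 2) k)"
proof -
  have "has_bochner_integral lborel (\<lambda>x::real. exp (- x\<^sup>2) * x ^ (2 * k))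
      (2 *\<^sub>R ((sqrt pi / 2) * (fact (2 * k) / (2 ^ (2 * k) * fact k))))"
    by (rule has_bochner_integral_even_function[OF gaussian_moment_even_pos]) simp
  moreover have "fact (2 * k) / (2 ^ (2 * k) * fact k) = (pochhammer (1 / 2) k :: real)"
    by (simp add: fact_double)
  ultimately show ?thesis by simp
qed

text \<open>
  Expanding \<open>exp (b x\<^sup>2)\<close> in powers of \<open>b\<close> and integrating term by term against \<open>exp (-x\<^sup>2)\<close>
  turns the exponential series into the binomial series of \<open>(1 - b) powr (-1/2)\<close>. This gives the
  principal branch at once; squaring the integral would leave its sign to be determined.
\<close>

lemma complex_gaussian_integral:
  fixes b :: complex
  assumes b: "norm b < 1"
  shows "(LINT x|lborel. exp (- (1 - b) * of_real (x\<^sup>2))) = of_real (sqrt pi) * (1 - b) powr (- 1 / 2)"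
proof -
  define f where "f k x = of_real (exp (- x\<^sup>2) * x ^ (2 * k)) * (b ^ k / fact k)" for k and x :: real
  have has: "has_bochner_integral lborel (\<lambda>x. of_real (exp (- x\<^sup>2) * x ^ (2 * k)) * c)
      (of_real (sqrt pi * pochhammer (1 / 2) k) * c)" for k and c :: "'a :: {real_normed_field,banach,second_countable_topology}"
    by (intro has_bochner_integral_mult_left has_bochner_integral_of_real gaussian_moment_even_pochhammer)
  have coeff: "((- 1 / 2) gchoose k) * (- z) ^ k = of_real (pochhammer (1 / 2) k) * (z ^ k / fact k)" for k and z :: complex
    by (simp add: gbinomial_pochhammer pochhammer_of_real[symmetric] power_minus[of z])
  have series: "(\<lambda>k. of_real (pochhammer (1 / 2) k) * (z ^ k / fact k)) sums (1 - z) powr (- 1 / 2)"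
    if "norm z < 1" for z :: complex
    using gen_binomial_complex[of "- z" "- 1 / 2"] that unfolding coeff by simp
  have norm_f: "norm (f k x) = exp (- x\<^sup>2) * x ^ (2 * k) * (norm b ^ k / fact k)" for k x
    by (simp add: f_def norm_mult norm_divide norm_power power_mult)
  have exp_series: "(\<lambda>k. exp (- x\<^sup>2) * x ^ (2 * k) * (norm b ^ k / fact k)) sums (exp (- x\<^sup>2) * exp (norm b * x\<^sup>2))" for x
    using sums_mult[OF exp_converges[of "norm b * x\<^sup>2"], of "exp (- x\<^sup>2)"]
    by (simp add: power_mult_distrib divide_inverse mult_ac flip: power_mult)
  have sum_f: "(\<lambda>k. f k x) sums exp (- (1 - b) * of_real (x\<^sup>2))" for x
  proof -
    have "(\<lambda>k. of_real (exp (- x\<^sup>2)) * ((b * of_real (x\<^sup>2)) ^ k /\<^sub>R fact k)) sums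
        (of_real (exp (- x\<^sup>2)) * exp (b * of_real (x\<^sup>2)))"
      by (intro sums_mult exp_converges)
    also have "(\<lambda>k. of_real (exp (- x\<^sup>2)) * ((b * of_real (x\<^sup>2)) ^ k /\<^sub>R fact k)) = (\<lambda>k. f k x)"
      by (simp add: f_def fun_eq_iff power_mult_distrib scaleR_conv_of_real divide_inverse mult_ac
          flip: power_mult)
    also have "of_real (exp (- x\<^sup>2)) * exp (b * of_real (x\<^sup>2)) = exp (- (1 - b) * of_real (x\<^sup>2))"
      by (simp add: algebra_simps flip: exp_of_real exp_add)
    finally show ?thesis .
  qed
  have "(\<lambda>k. integral\<^sup>L lborel (f k)) sums (LINT x|lborel. (\<Sum>k. f k x))"
  proof (rule sums_integral)
    show "integrable lborel (f k)" for k
      using has[of k "b ^ k / fact k"] unfolding f_def by (rule integrable.intros)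
    show "AE x in lborel. summable (\<lambda>k. norm (f k x))"
      unfolding norm_f using exp_series sums_summable by blast
    have "(LINT x|lborel. norm (f k x)) = sqrt pi * pochhammer (1 / 2) k * (norm b ^ k / fact k)" for k
      unfolding norm_f using has_bochner_integral_integral_eq[OF has[of k "norm b ^ k / fact k"]] by simp
    moreover have "summable (\<lambda>k. sqrt pi * pochhammer (1 / 2) k * (norm b ^ k / fact k))"
    proof -
      have "summable (\<lambda>k. of_real (pochhammer (1 / 2) k) * (of_real (norm b) ^ k / fact k) :: complex)"
        using b by (intro sums_summable[OF series]) simp
      also have "(\<lambda>k. of_real (pochhammer (1 / 2) k) * (of_real (norm b) ^ k / fact k) :: complex)
          = (\<lambda>k. of_real (pochhammer (1 / 2) k * (norm b ^ k / fact k)))" by simp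
      finally show ?thesis
        unfolding summable_of_real_iff mult.assoc by (rule summable_mult)
    qed
    ultimately show "summable (\<lambda>k. LINT x|lborel. norm (f k x))" by simp
  qed
  also have "(\<lambda>x. \<Sum>k. f k x) = (\<lambda>x. exp (- (1 - b) * of_real (x\<^sup>2)))"
    using sum_f by (auto simp: sums_iff)
  finally have "(\<lambda>k. of_real (sqrt pi) * (of_real (pochhammer (1 / 2) k) * (b ^ k / fact k)))
      sums (LINT x|lborel. exp (- (1 - b) * of_real (x\<^sup>2)))"
    unfolding f_def has_bochner_integral_integral_eq[OF has] by (simp add: mult_ac)
  moreover have "(\<lambda>k. of_real (sqrt pi) * (of_real (pochhammer (1 / 2) k) * (b ^ k / fact k)))
      sums (of_real (sqrt pi) * (1 - b) powr (- 1 / 2))"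
    by (intro sums_mult series b)
  ultimately show ?thesis by (rule sums_unique2)
qed

lemma saddle_gaussian_integral:
  "(LINT x|lborel. exp (- (1 - \<i>) * of_real (x\<^sup>2 / 2))) = of_real (sqrt pi * 2 powr (1/4)) * cis (pi / 8)"
proof -
  \<comment> \<open>the choice with \<open>1 - b = (1 - \<i>) / 2\<close>; its norm is \<open>1 / sqrt 2\<close>\<close>
  define b where "b = (1 + \<i>) / 2"
  have "norm b < 1" by (simp add: b_def norm_divide cmod_def real_less_lsqrt power2_eq_square)
  have half: "1 - b = (1 - \<i>) / 2" by (simp add: b_def field_simps)
  have 1: "- (1 - b) * of_real (x\<^sup>2) = - (1 - \<i>) * of_real (x\<^sup>2 / 2)" for x
    unfolding half by (simp add: field_simps)
  have "1 - b = of_real (2 powr (-1/2)) * cis (- pi / 4)"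
    by (simp add: complex_eq_iff b_def cos_45 sin_45 powr_minus powr_half_sqrt field_simps)
  also have "\<dots> = exp (Complex (- ln 2 / 2) (- pi / 4))"
    by (simp add: exp_eq_polar powr_def)
  finally have e: "1 - b = exp (Complex (- ln 2 / 2) (- pi / 4))" .
  have "Ln (1 - b) = Complex (- ln 2 / 2) (- pi / 4)"
    unfolding e by (rule Ln_exp) (use pi_gt_zero in \<open>auto intro: order_trans[of _ 0]\<close>)
  then have "(1 - b) powr (- 1 / 2) = exp (- 1 / 2 * Complex (- ln 2 / 2) (- pi / 4))"
    using e by (simp add: powr_def)
  also have "- 1 / 2 * Complex (- ln 2 / 2) (- pi / 4) = Complex (ln 2 / 4) (pi / 8)"
    by (simp add: complex_eq_iff)
  also have "exp \<dots> = of_real (2 powr (1/4)) * cis (pi / 8)"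
    by (simp add: exp_eq_polar powr_def)
  finally show ?thesis
    using complex_gaussian_integral[OF \<open>norm b < 1\<close>] unfolding 1 by simp
qed

section \<open>The asymptotic formula\<close>

theorem mainTheorem1:
  "(\<lambda>t::real. S t - 2 * pi powr (1/4) * exp (- sqrt (2 * pi * t))
        * (cos (sqrt (2 * pi * t) + pi / 8) / t powr (1/4)))
     \<in> o[at_top](\<lambda>t. t powr (-1/4) * exp (- sqrt (2 * pi * t)))"
proof (rule smalloI_tendsto)
  define l where "l t = sqrt (2 * pi * t)" for t
  define J where "J l = (LINT x|lborel. saddle_integrand l x)" for l
  define G where "G = of_real (sqrt pi * 2 powr (1/4)) * cis (pi / 8)"
  define C where "C = 2 / (2 * pi) powr (1/4)"
  define main where "main t = 2 * pi powr (1/4) * exp (- l t) * (cos (l t + pi / 8) / t powr (1/4))" for t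
  have J: "(J \<longlongrightarrow> G) at_top"
    unfolding J_def G_def saddle_gaussian_integral[symmetric] by (rule saddle_integral_tendsto)
  have "filterlim l at_top at_top" unfolding l_def by real_asymp
  from filterlim_compose[OF J this] have Jl: "((\<lambda>t. J (l t)) \<longlongrightarrow> G) at_top" .
  have rotate: "exp (- (1 - \<i>) * of_real s) = of_real (exp (- s)) * cis s" for s
    by (simp add: cis_conv_exp algebra_simps flip: exp_of_real exp_add)
  have quot: "(S t - main t) / (t powr (- 1 / 4) * exp (- l t)) = C * Re (cis (l t) * (J (l t) - G))"
    if "t \<ge> 1" for t
  proof -
    have sl: "sqrt (l t) = (2 * pi) powr (1/4) * t powr (1/4)"
      using that unfolding l_def by (simp add: powr_half_sqrt[symmetric] powr_powr powr_mult)
    have c: "C * (sqrt pi * 2 powr (1/4)) = 2 * pi powr (1/4)"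
    proof -
      have "sqrt pi = pi powr (1/4) * pi powr (1/4)"
        by (simp add: powr_half_sqrt[symmetric] flip: powr_add)
      then show ?thesis by (simp add: C_def powr_mult)
    qed
    have S: "S t = C / t powr (1/4) * exp (- l t) * Re (cis (l t) * J (l t))"
      using S_eq_saddle_integral[OF that] unfolding l_def[symmetric] J_def[symmetric] rotate sl C_def
      by (simp add: field_simps)
    have "Re (cis (l t) * G) = sqrt pi * 2 powr (1/4) * cos (l t + pi / 8)"
      unfolding cos_add by (simp add: G_def algebra_simps)
    then have "main t = C / t powr (1/4) * exp (- l t) * Re (cis (l t) * G)"
      using c by (simp add: main_def)
    then have "S t - main t = C / t powr (1/4) * exp (- l t) * Re (cis (l t) * (J (l t) - G))"
      unfolding S by (simp only: right_diff_distrib minus_complex.sel)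
    then show ?thesis using that by (simp add: powr_minus field_simps)
  qed
  have dist: "((\<lambda>t. norm (J (l t) - G)) \<longlongrightarrow> 0) at_top"
    by (intro tendsto_norm_zero LIM_zero Jl)
  have le: "\<bar>Re (cis (l t) * (J (l t) - G))\<bar> \<le> norm (J (l t) - G)" for t
    using abs_Re_le_cmod[of "cis (l t) * (J (l t) - G)"] by (simp add: norm_mult)
  have "((\<lambda>t. Re (cis (l t) * (J (l t) - G))) \<longlongrightarrow> 0) at_top"
    by (intro Lim_null_comparison[OF _ dist] always_eventually allI) (simp only: real_norm_def le)
  then have "((\<lambda>t. C * Re (cis (l t) * (J (l t) - G))) \<longlongrightarrow> 0) at_top"
    by (rule tendsto_mult_right_zero)
  moreover have "\<forall>\<^sub>F t in at_top. C * Re (cis (l t) * (J (l t) - G))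
      = (S t - main t) / (t powr (- 1 / 4) * exp (- l t))"
    using eventually_ge_at_top[of 1] by eventually_elim (simp only: quot)
  ultimately have "((\<lambda>t. (S t - main t) / (t powr (- 1 / 4) * exp (- l t))) \<longlongrightarrow> 0) at_top"
    by (rule Lim_transform_eventually)
  then show "((\<lambda>t. (S t - 2 * pi powr (1/4) * exp (- sqrt (2 * pi * t))
        * (cos (sqrt (2 * pi * t) + pi / 8) / t powr (1/4)))
      / (t powr (-1/4) * exp (- sqrt (2 * pi * t)))) \<longlongrightarrow> 0) at_top"
    unfolding main_def l_def .
  show "\<forall>\<^sub>F t in at_top. t powr (-1/4) * exp (- sqrt (2 * pi * t)) \<noteq> 0"
    using eventually_gt_at_top[of 0] by eventually_elim simp
qed

end
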